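(* Let $a>0$ and $\gamma\ge0$ be real. Then for every integer $n\ge0$, as polynomials in $x$, $$\mathscr{C}_n(x;a,\gamma)=\sum_{k=0}^{n}(-a)^{-k}\frac{(-n)_k(\gamma-x)_k}{k!}\;{}_3F_2\left(\begin{array}{c}-k,\ \gamma,\ k-n\\ -n,\ \gamma-x\end{array}\Big|\,1\right).$$
   Context: The associated Charlier polynomials $\mathscr{C}_n(x;a,\gamma)$ are defined by $\mathscr{C}_{-1}=0$, $\mathscr{C}_0=1$ and, for $n\ge0$, $$a\,\mathscr{C}_{n+1}(x;a,\gamma)=(n+\gamma+a-x)\,\mathscr{C}_n(x;a,\gamma)-(n+\gamma)\,\mathscr{C}_{n-1}(x;a,\gamma).$$ Pochhammer symbol: $(b)_0=1$, $(b)_k=b(b+1)\cdots(b+k-1)$. The terminating series is ${}_3F_2\left(\begin{array}{c}-k,\gamma,k-n\\ -n,\gamma-x\end{array}\Big|1\right)=\sum_{j=0}^{\min(k,n-k)}\frac{(-k)_j(\gamma)_j(k-n)_j}{(-n)_j(\gamma-x)_j\,j!}$. Convention: since $j\le k$, the quotient $(\gamma-x)_k/(\gamma-x)_j$ is a polynomial in $x$, so at the finitely many $x$ where $(\gamma-x)_j$ vanishes the right-hand side is understood by continuity in $x$. *)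

theory Defs
  imports "HOL-Analysis.Analysis" "HOL-Computational_Algebra.Polynomial"
begin

text \<open>Associated Charlier polynomials as elements of \<open>\<real>[x]\<close>, so \<open>poly (assoc_charlier a \<gamma> n) x\<close> is
  \<open>\<C>\<^sub>n(x; a, \<gamma>)\<close>. The recurrence is solved for \<open>\<C>\<^sub>n\<^sub>+\<^sub>1\<close>, which is meant for \<open>a \<noteq> 0\<close>;
  the case distinction encodes \<open>\<C>\<^sub>-\<^sub>1 = 0\<close>.\<close>

fun assoc_charlier :: "real \<Rightarrow> real \<Rightarrow> nat \<Rightarrow> real poly" where
  "assoc_charlier a \<gamma> 0 = 1"
| "assoc_charlier a \<gamma> (Suc n) =
     smult (1 / a)
       ([:real n + \<gamma> + a, -1:] * assoc_charlier a \<gamma> n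
        - smult (real n + \<gamma>) (case n of 0 \<Rightarrow> 0 | Suc m \<Rightarrow> assoc_charlier a \<gamma> m))"

text \<open>The partial sum of \<open>\<^sub>3F\<^sub>2\<close> over \<open>j \<le> N\<close>. For a terminating series whose lower parameter may be
  a negative integer, \<open>N\<close> has to be fixed explicitly.\<close>

definition hypergeom_3F2_upto :: "nat \<Rightarrow> 'a \<Rightarrow> 'a \<Rightarrow> 'a \<Rightarrow> 'a \<Rightarrow> 'a \<Rightarrow> 'a \<Rightarrow> 'a::field_char_0" where
  "hypergeom_3F2_upto N a\<^sub>1 a\<^sub>2 a\<^sub>3 b\<^sub>1 b\<^sub>2 z =
     (\<Sum>j\<le>N. pochhammer a\<^sub>1 j * pochhammer a\<^sub>2 j * pochhammer a\<^sub>3 j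
             / (pochhammer b\<^sub>1 j * pochhammer b\<^sub>2 j * fact j) * z ^ j)"

text \<open>The right-hand side of the identity, with literal division. Because of \<open>t / 0 = 0\<close> it has the
  intended value only where \<open>pochhammer (\<gamma> - x) j \<noteq> 0\<close> for all occurring \<open>j\<close>, that is, for all
  \<open>j \<le> n div 2\<close>; at the other \<open>x\<close> the intended value is its limit.\<close>

definition charlier_3F2_sum :: "real \<Rightarrow> real \<Rightarrow> nat \<Rightarrow> real \<Rightarrow> real" where
  "charlier_3F2_sum a \<gamma> n x =
     (\<Sum>k=0..n. (- a) powi (- int k) * (pochhammer (- real n) k * pochhammer (\<gamma> - x) k / fact k)
        * hypergeom_3F2_upto (min k (n - k))
            (- real k) \<gamma> (real k - real n) (- real n) (\<gamma> - x) 1)"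

end

(* Put y = gamma - x. Writing the Pochhammer quotients as binomials, the k-th summand on the right is
   a^(-k) A(n,k) with A(n,k) = sum_j (-1)^j C(n-j,k) C(k,j) (gamma)_j (y+j)_(k-j), a polynomial in x.
   Comparing powers of 1/a, the three-term recurrence amounts to
   A(n+1,k+1) = (n+y) A(n,k) + A(n,k+1) - (n+gamma) A(n-1,k).
   Pascal's rule applied to both binomials, an index shift and N C(N-1,k) = (N-k) C(N,k) give it. *)
theory Submission
  imports Defs
begin

text \<open>The binomials vanish for \<open>j > k\<close> and for \<open>k > n - j\<close>. If \<open>j > n\<close>, the truncated \<open>n - j\<close> is \<open>0\<close>,
  and the first binomial still vanishes since \<open>k \<ge> j > 0\<close>.\<close>

definition charlier_coeff :: "real \<Rightarrow> real \<Rightarrow> nat \<Rightarrow> nat \<Rightarrow> real" where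
  "charlier_coeff \<gamma> y n k =
     (\<Sum>j\<le>k. (- 1) ^ j * real ((n - j) choose k) * real (k choose j)
            * pochhammer \<gamma> j * pochhammer (y + real j) (k - j))"

text \<open>The two symbols share the factor \<open>pochhammer (y + 1) r\<close>; their remaining
  factors \<open>y + 1 + of_nat r\<close> and \<open>y\<close> differ by
  \<open>of_nat (Suc r)\<close>.\<close>

lemma pochhammer_add_one:
  fixes y :: "'a::comm_ring_1"
  shows "pochhammer (y + 1) (Suc r) = pochhammer y (Suc r) + of_nat (Suc r) * pochhammer (y + 1) r"
proof -
  have "pochhammer y (Suc r) = y * pochhammer (y + 1) r"
    by (simp add: pochhammer_rec)
  moreover have "pochhammer (y + 1) (Suc r) = pochhammer (y + 1) r * (y + 1 + of_nat r)"
    by (rule pochhammer_Suc)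
  ultimately show ?thesis
    by (simp add: algebra_simps)
qed

text \<open>For \<open>k > Suc N\<close>, where natural subtraction would truncate, both binomials
  vanish.\<close>

lemma binomial_absorb_lower:
  "real (Suc N) * real (N choose k) = (real (Suc N) - real k) * real (Suc N choose k)"
proof (cases "k \<le> Suc N")
  case True
  have "Suc N * (N choose k) = (Suc N - k) * (Suc N choose k)"
    using binomial_absorb_comp[of "Suc N" k] by simp
  then have "real (Suc N) * real (N choose k) = real (Suc N - k) * real (Suc N choose k)"
    by (metis of_nat_mult)
  with True show ?thesis by (simp add: of_nat_diff)
qed (simp add: binomial_eq_0)

lemma charlier_coeff_zero [simp]: "charlier_coeff \<gamma> y n 0 = 1"
  by (simp add: charlier_coeff_def)

lemma charlier_coeff_eq_zero: "n < k \<Longrightarrow> charlier_coeff \<gamma> y n k = 0"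
  by (auto simp: charlier_coeff_def intro!: sum.neutral)

text \<open>The difference of the two coefficients at \<open>Suc k\<close> is reduced to the terms
  \<open>s j * c j * q j\<close> and \<open>t j * c j * q j\<close>, the summands of the
  coefficients at \<open>Suc m\<close> and \<open>m\<close>.\<close>

lemma charlier_coeff_rec:
  "charlier_coeff \<gamma> y (Suc (Suc m)) (Suc k) =
     (real (Suc m) + y) * charlier_coeff \<gamma> y (Suc m) k + charlier_coeff \<gamma> y (Suc m) (Suc k)
     - (real (Suc m) + \<gamma>) * charlier_coeff \<gamma> y m k"
proof -
  define q where "q j = (- 1) ^ j * pochhammer \<gamma> j * pochhammer (y + real j) (k - j)" for j
  define c where "c j = real (k choose j)" for j
  define s where "s j = real ((Suc m - j) choose k)" for j
  define t where "t j = real ((m - j) choose k)" for j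
  have A1: "charlier_coeff \<gamma> y (Suc m) k = (\<Sum>j\<le>k. s j * c j * q j)"
    and A0: "charlier_coeff \<gamma> y m k = (\<Sum>j\<le>k. t j * c j * q j)"
    by (auto simp: charlier_coeff_def s_def t_def c_def q_def intro!: sum.cong)
  have s_Suc: "s (Suc j) = t j" for j
    by (simp add: s_def t_def)
  let ?p = "\<lambda>j. (- 1) ^ j * pochhammer \<gamma> j * pochhammer (y + real j) (Suc k - j)"
  have pascal: "real ((Suc (Suc m) - j) choose Suc k) - real ((Suc m - j) choose Suc k) = s j"
    if "j \<le> Suc k" for j
  proof (cases "j \<le> Suc m")
    case True
    then have "Suc (Suc m) - j = Suc (Suc m - j)" by simp
    then show ?thesis by (simp add: s_def)
  next
    \<comment> \<open>All truncated differences are 0 here, and \<open>j \<le> Suc k\<close> forces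
      \<open>k > 0\<close>, so every binomial vanishes.\<close>
    case False
    with that show ?thesis by (auto simp: s_def)
  qed
  have "charlier_coeff \<gamma> y (Suc (Suc m)) (Suc k) - charlier_coeff \<gamma> y (Suc m) (Suc k)
      = (\<Sum>j\<le>Suc k. s j * real (Suc k choose j) * ?p j)"
    unfolding charlier_coeff_def sum_subtractf[symmetric]
    by (intro sum.cong refl) (simp add: pascal[symmetric] algebra_simps)
  \<comment> \<open>Pascal's rule for \<open>Suc k choose j\<close>; the case distinction supplies 0
    for the missing lower binomial at \<open>j = 0\<close>.\<close>
  also have "\<dots> = (\<Sum>j\<le>Suc k. s j * c j * ?p j)
      + (\<Sum>j\<le>Suc k. s j * (case j of 0 \<Rightarrow> 0 | Suc i \<Rightarrow> c i) * ?p j)"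
    unfolding sum.distrib[symmetric]
    by (intro sum.cong refl) (simp add: c_def algebra_simps split: nat.split)
  also have "(\<Sum>j\<le>Suc k. s j * c j * ?p j) = (\<Sum>j\<le>k. s j * c j * ?p j)"
    by (simp add: c_def)
  \<comment> \<open>The last factor of the symbol in \<open>?p j\<close> is
    \<open>y + real k\<close>, independent of \<open>j\<close>.\<close>
  also have "\<dots> = (\<Sum>j\<le>k. (y + real k) * (s j * c j * q j))"
    by (intro sum.cong refl) (simp add: q_def Suc_diff_le pochhammer_Suc of_nat_diff algebra_simps)
  also have "(\<Sum>j\<le>Suc k. s j * (case j of 0 \<Rightarrow> 0 | Suc i \<Rightarrow> c i) * ?p j)
      = (\<Sum>j\<le>k. t j * c j * ?p (Suc j))"
    by (subst sum.atMost_Suc_shift) (simp add: s_Suc)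
  \<comment> \<open>For \<open>j < k\<close>, \<open>pochhammer_add_one\<close> splits the symbol
    starting at \<open>y + real (Suc j)\<close>: one part gives
    \<open>- (\<gamma> + real j) * q j\<close>, the other \<open>(k - j) * q (Suc j)\<close>, where
    \<open>(k - j) * c j = Suc j * c (Suc j)\<close>.\<close>
  also have "\<dots> = (\<Sum>j\<le>k. s (Suc j) * (real (Suc j) * c (Suc j)) * q (Suc j))
      - (\<Sum>j\<le>k. (\<gamma> + real j) * (t j * c j * q j))"
    unfolding sum_subtractf[symmetric]
  proof (intro sum.cong refl)
    fix j assume "j \<in> {..k}"
    show "t j * c j * ?p (Suc j) = s (Suc j) * (real (Suc j) * c (Suc j)) * q (Suc j)
        - (\<gamma> + real j) * (t j * c j * q j)"
    proof (cases "k = j")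
      case True
      then have "c (Suc j) = 0"
        by (simp add: c_def)
      with True show ?thesis
        by (simp add: q_def pochhammer_Suc algebra_simps)
    next
      case False
      with \<open>j \<in> {..k}\<close> obtain r where r: "k = j + Suc r"
        by (metis atMost_iff le_neq_implies_less less_iff_Suc_add add_Suc_right)
      have "Suc j * (k choose Suc j) = (k choose j) * (k - j)"
        by (metis binomial_absorb_comp binomial_absorption mult.commute r add_Suc_right diff_Suc_1)
      then have *: "real (Suc j) * c (Suc j) = c j * real (Suc r)"
        unfolding c_def using r by (metis add_diff_cancel_left' of_nat_mult)
      have p: "pochhammer (y + real (Suc j)) (Suc r)
          = pochhammer (y + real j) (Suc r) + real (Suc r) * pochhammer (y + real (Suc j)) r"
        using pochhammer_add_one[of "y + real j" r] by (simp add: add_ac)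
      have "Suc k - Suc j = Suc r" "k - j = Suc r" "k - Suc j = r"
        using r by simp_all
      then show ?thesis
        unfolding s_Suc * q_def p pochhammer_Suc[of \<gamma>] power_Suc
        by (simp only: p) (simp only: algebra_simps)
    qed
  qed
  \<comment> \<open>The shift back adds only a term at \<open>j = 0\<close>, which carries the
    factor 0; afterwards the top term drops out since \<open>c (Suc k) = 0\<close>.\<close>
  also have "(\<Sum>j\<le>k. s (Suc j) * (real (Suc j) * c (Suc j)) * q (Suc j))
      = (\<Sum>j\<le>Suc k. s j * (real j * c j) * q j)"
    by (subst sum.atMost_Suc_shift) simp
  also have "\<dots> = (\<Sum>j\<le>k. real j * (s j * c j * q j))"
    by (simp add: c_def mult_ac)
  finally have diff: "charlier_coeff \<gamma> y (Suc (Suc m)) (Suc k) - charlier_coeff \<gamma> y (Suc m) (Suc k)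
      = (\<Sum>j\<le>k. (y + real k) * (s j * c j * q j)) + ((\<Sum>j\<le>k. real j * (s j * c j * q j))
        - (\<Sum>j\<le>k. (\<gamma> + real j) * (t j * c j * q j)))" .
  \<comment> \<open>For \<open>j > m\<close> both truncated differences are 0 while
    \<open>k > 0\<close>, so \<open>s j = t j = 0\<close>.\<close>
  have absorb: "(real (Suc m) - real j) * t j = (real (Suc m) - real j - real k) * s j"
    if "j \<le> k" for j
  proof (cases "j \<le> m")
    case True
    then have "Suc m - j = Suc (m - j)" by simp
    then show ?thesis
      using binomial_absorb_lower[of "m - j" k] True
      by (simp add: s_def t_def of_nat_diff algebra_simps)
  next
    case False
    with that show ?thesis by (cases "j = Suc m") (auto simp: s_def t_def)
  qed
  \<comment> \<open>Summand by summand, the two sides differ by \<open>absorb\<close> multiplied by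
    \<open>c j * q j\<close>.\<close>
  have "(\<Sum>j\<le>k. (y + real k) * (s j * c j * q j)) + ((\<Sum>j\<le>k. real j * (s j * c j * q j))
        - (\<Sum>j\<le>k. (\<gamma> + real j) * (t j * c j * q j)))
      = (\<Sum>j\<le>k. (real (Suc m) + y) * (s j * c j * q j) - (real (Suc m) + \<gamma>) * (t j * c j * q j))"
    unfolding sum.distrib[symmetric] sum_subtractf[symmetric]
  proof (intro sum.cong refl)
    fix j assume "j \<in> {..k}"
    then have "(real (Suc m) - real j) * t j * (c j * q j)
        = (real (Suc m) - real j - real k) * s j * (c j * q j)"
      using absorb by simp
    then show "(y + real k) * (s j * c j * q j)
        + (real j * (s j * c j * q j) - (\<gamma> + real j) * (t j * c j * q j))
        = (real (Suc m) + y) * (s j * c j * q j) - (real (Suc m) + \<gamma>) * (t j * c j * q j)"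
      by (simp only: algebra_simps)
  qed
  with diff show ?thesis
    by (simp add: A1 A0 sum_subtractf sum_distrib_left)
qed

text \<open>Two-step induction along the recurrence. The constant term 1 is split off so that
  \<open>charlier_coeff_rec\<close> covers all other powers of \<open>1 / a\<close>.\<close>

lemma poly_assoc_charlier:
  assumes "a \<noteq> 0"
  shows "poly (assoc_charlier a \<gamma> n) x = (\<Sum>k\<le>n. charlier_coeff \<gamma> (\<gamma> - x) n k / a ^ k)"
proof (induction n rule: induct_nat_012)
  case 0
  then show ?case by simp
next
  case 1
  then show ?case using assms by (simp add: charlier_coeff_def field_simps)
next
  case (ge2 m)
  define y where "y = \<gamma> - x"
  let ?A = "charlier_coeff \<gamma> y"
  have "(\<Sum>k\<le>Suc (Suc m). ?A (Suc (Suc m)) k / a ^ k)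
      = 1 + (\<Sum>k\<le>Suc m. ?A (Suc (Suc m)) (Suc k) / a ^ Suc k)"
    by (subst sum.atMost_Suc_shift) simp
  also have "(\<Sum>k\<le>Suc m. ?A (Suc (Suc m)) (Suc k) / a ^ Suc k)
      = (\<Sum>k\<le>Suc m. (real (Suc m) + y) / a * (?A (Suc m) k / a ^ k)
          + ?A (Suc m) (Suc k) / a ^ Suc k - (real (Suc m) + \<gamma>) / a * (?A m k / a ^ k))"
    using assms by (intro sum.cong refl) (simp add: charlier_coeff_rec field_simps del: of_nat_Suc)
  also have "\<dots> = (real (Suc m) + y) / a * (\<Sum>k\<le>Suc m. ?A (Suc m) k / a ^ k)
      + (\<Sum>k\<le>Suc m. ?A (Suc m) (Suc k) / a ^ Suc k)
      - (real (Suc m) + \<gamma>) / a * (\<Sum>k\<le>Suc m. ?A m k / a ^ k)"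
    by (simp only: sum_subtractf sum.distrib sum_distrib_left)
  also have "(\<Sum>k\<le>Suc m. ?A m k / a ^ k) = (\<Sum>k\<le>m. ?A m k / a ^ k)"
    by (simp add: charlier_coeff_eq_zero)
  \<comment> \<open>Reindexing restores the term at \<open>k = 0\<close>; the 1 subtracted here
    cancels the one split off above.\<close>
  also have "(\<Sum>k\<le>Suc m. ?A (Suc m) (Suc k) / a ^ Suc k)
      = (\<Sum>k\<le>Suc (Suc m). ?A (Suc m) k / a ^ k) - 1"
    by (subst sum.atMost_Suc_shift[of _ "Suc m"]) simp
  also have "(\<Sum>k\<le>Suc (Suc m). ?A (Suc m) k / a ^ k) = (\<Sum>k\<le>Suc m. ?A (Suc m) k / a ^ k)"
    by (subst sum.atMost_Suc) (simp add: charlier_coeff_eq_zero)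
  finally show ?case
    using assms unfolding y_def[symmetric] assoc_charlier.simps(2)[of _ _ "Suc m"]
    by (simp add: ge2.IH[folded y_def] del: sum.atMost_Suc assoc_charlier.simps)
       (simp add: y_def field_simps del: sum.atMost_Suc)
qed

lemma pochhammer_minus_of_nat:
  "pochhammer (- real n) k = (- 1) ^ k * fact k * real (n choose k)"
  using gbinomial_pochhammer[of "real n" k] by (simp add: binomial_gbinomial)

text \<open>By \<open>nz\<close> the symbols in \<open>y\<close> cancel to
  \<open>pochhammer (y + real j) (k - j)\<close>; the three symbols with negated integer arguments
  contribute the sign \<open>(- 1) ^ j\<close> and a quotient of binomials.\<close>

lemma charlier_3F2_term:
  assumes "k \<le> n" and nz: "\<And>j. j \<le> min k (n - k) \<Longrightarrow> pochhammer y j \<noteq> 0"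
  shows "pochhammer (- real n) k * pochhammer y k / fact k
      * hypergeom_3F2_upto (min k (n - k)) (- real k) \<gamma> (real k - real n) (- real n) y 1
    = (- 1) ^ k * charlier_coeff \<gamma> y n k"
proof -
  have "pochhammer (- real n) k * pochhammer y k / fact k
      * hypergeom_3F2_upto (min k (n - k)) (- real k) \<gamma> (real k - real n) (- real n) y 1
    = (\<Sum>j\<le>min k (n - k). (- 1) ^ k * ((- 1) ^ j * real ((n - j) choose k) * real (k choose j)
            * pochhammer \<gamma> j * pochhammer (y + real j) (k - j)))"
    unfolding hypergeom_3F2_upto_def sum_distrib_left
  proof (intro sum.cong refl)
    fix j assume j: "j \<in> {..min k (n - k)}"
    then have le: "j \<le> k" "j \<le> n - k" "j \<le> n" "k \<le> n - j" using assms(1) by auto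
    have "real k - real n = - real (n - k)" using assms(1) by simp
    note p = this pochhammer_minus_of_nat
    have y: "pochhammer y k = pochhammer y j * pochhammer (y + real j) (k - j)"
      using pochhammer_product[OF le(1), of y] by simp
    have "n - k - j = n - j - k" by simp
    \<comment> \<open>Both sides equal n! / (k! j! (n-k-j)!).\<close>
    then have "real (n choose k) * real ((n - k) choose j) = real (n choose j) * real ((n - j) choose k)"
      using le assms(1) by (simp add: binomial_fact)
    moreover have "real (n choose j) \<noteq> 0" using le by simp
    ultimately have b: "real ((n - j) choose k) = real (n choose k) * real ((n - k) choose j) / real (n choose j)"
      by (simp add: field_simps)
    show "pochhammer (- real n) k * pochhammer y k / fact k
        * (pochhammer (- real k) j * pochhammer \<gamma> j * pochhammer (real k - real n) j
          / (pochhammer (- real n) j * pochhammer y j * fact j) * 1 ^ j)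
      = (- 1) ^ k * ((- 1) ^ j * real ((n - j) choose k) * real (k choose j)
            * pochhammer \<gamma> j * pochhammer (y + real j) (k - j))"
      unfolding p y b using nz[of j] j le by (simp add: field_simps)
  qed
  also have "\<dots> = (- 1) ^ k * (\<Sum>j\<le>min k (n - k). (- 1) ^ j * real ((n - j) choose k)
      * real (k choose j) * pochhammer \<gamma> j * pochhammer (y + real j) (k - j))"
    by (simp only: sum_distrib_left)
  \<comment> \<open>The terms with \<open>n - k < j \<le> k\<close> vanish because then
    \<open>n - j < k\<close>.\<close>
  also have "(\<Sum>j\<le>min k (n - k). (- 1) ^ j * real ((n - j) choose k)
      * real (k choose j) * pochhammer \<gamma> j * pochhammer (y + real j) (k - j)) = charlier_coeff \<gamma> y n k"
    unfolding charlier_coeff_def using assms(1) by (intro sum.mono_neutral_left) auto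
  finally show ?thesis .
qed

text \<open>The bound \<open>n div 2\<close> suffices since
  \<open>min k (n - k) \<le> n div 2\<close>; the sign \<open>(- 1) ^ k\<close> of each term turns
  the power of \<open>- a\<close> into \<open>1 / a ^ k\<close>.\<close>

lemma poly_assoc_charlier_eq_3F2_sum:
  assumes "a \<noteq> 0" and nz: "\<And>j. j \<le> n div 2 \<Longrightarrow> pochhammer (\<gamma> - x) j \<noteq> 0"
  shows "poly (assoc_charlier a \<gamma> n) x = charlier_3F2_sum a \<gamma> n x"
  unfolding poly_assoc_charlier[OF assms(1)] charlier_3F2_sum_def atMost_atLeast0
proof (intro sum.cong refl)
  fix k assume k: "k \<in> {0..n}"
  have "(- a) powi (- int k) * (- 1) ^ k = inverse (- a) ^ k * (- 1) ^ k"
    by (simp only: power_int_minus power_int_of_nat power_inverse)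
  also have "\<dots> = 1 / a ^ k"
    unfolding power_mult_distrib[symmetric] by (simp add: power_one_over inverse_eq_divide)
  finally have pow: "(- a) powi (- int k) * (- 1) ^ k = 1 / a ^ k" .
  have coeff: "pochhammer (- real n) k * pochhammer (\<gamma> - x) k / fact k
      * hypergeom_3F2_upto (min k (n - k)) (- real k) \<gamma> (real k - real n) (- real n) (\<gamma> - x) 1
    = (- 1) ^ k * charlier_coeff \<gamma> (\<gamma> - x) n k"
    by (rule charlier_3F2_term) (use k in \<open>auto intro!: nz\<close>)
  show "charlier_coeff \<gamma> (\<gamma> - x) n k / a ^ k
    = (- a) powi (- int k) * (pochhammer (- real n) k * pochhammer (\<gamma> - x) k / fact k)
        * hypergeom_3F2_upto (min k (n - k))
            (- real k) \<gamma> (real k - real n) (- real n) (\<gamma> - x) 1"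
    unfolding mult.assoc[of "(- a) powi (- int k)"] coeff
    unfolding mult.assoc[symmetric] pow by simp
qed

text \<open>The second conjunct expresses the convention by continuity: where a denominator
  vanishes, the limit of \<open>charlier_3F2_sum\<close> replaces its value.\<close>

theorem mainTheorem8:
  fixes a \<gamma> :: real and n :: nat
  assumes "a > 0" and "\<gamma> \<ge> 0"
  shows "(\<forall>x. (\<forall>j\<le>n div 2. pochhammer (\<gamma> - x) j \<noteq> 0)
              \<longrightarrow> poly (assoc_charlier a \<gamma> n) x = charlier_3F2_sum a \<gamma> n x)
       \<and> (\<forall>x. (charlier_3F2_sum a \<gamma> n \<longlongrightarrow> poly (assoc_charlier a \<gamma> n) x) (at x))"
proof (intro conjI allI impI)
  fix x assume "\<forall>j\<le>n div 2. pochhammer (\<gamma> - x) j \<noteq> 0"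
  then show "poly (assoc_charlier a \<gamma> n) x = charlier_3F2_sum a \<gamma> n x"
    using assms(1) by (intro poly_assoc_charlier_eq_3F2_sum) auto
next
  fix x
  \<comment> \<open>Contains every \<open>z\<close> at which a denominator vanishes:
    \<open>pochhammer (\<gamma> - z) j = 0\<close> forces \<open>z = \<gamma> + real i\<close> with
    \<open>i < j\<close>.\<close>
  let ?S = "(\<lambda>i. \<gamma> + real i) ` {..<n}"
  have "poly (assoc_charlier a \<gamma> n) z = charlier_3F2_sum a \<gamma> n z" if "z \<notin> ?S" for z
  proof (rule poly_assoc_charlier_eq_3F2_sum)
    fix j assume "j \<le> n div 2"
    with that show "pochhammer (\<gamma> - z) j \<noteq> 0"
      by (force simp: pochhammer_eq_0_iff algebra_simps)
  qed (use assms(1) in simp)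
  \<comment> \<open>A finite set has no limit point, so equality holds on a punctured neighbourhood
    of \<open>x\<close>, and continuity of the polynomial gives the limit.\<close>
  moreover have "\<forall>\<^sub>F z in at x. z \<notin> ?S"
    using islimpt_finite[of ?S x] by (simp add: islimpt_iff_eventually)
  ultimately have "\<forall>\<^sub>F z in at x. poly (assoc_charlier a \<gamma> n) z = charlier_3F2_sum a \<gamma> n z"
    by (auto elim: eventually_mono)
  then show "(charlier_3F2_sum a \<gamma> n \<longlongrightarrow> poly (assoc_charlier a \<gamma> n) x) (at x)"
    by (rule Lim_transform_eventually[rotated]) (intro tendsto_intros)
qed

end
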